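(* Let $n$ be a positive integer. Assume that $\mathcal{Y}$ is a closed linear subspace of $\overline{\mathcal{C}_0}(\mathbf{R}^n)$ such that $\mathcal{Y}$ is a subset of $[\mathcal{F}L^1](\mathbf{R}^n)$. Then there are positive numbers $\alpha$ and $C$ such that for every $\mathcal{F}f\in\mathcal{Y}$ $$\sup_{\xi\in\mathbf{R}^n}|[\mathcal{F}f](\xi)|\;\le\; C\,\sup_{\xi\in\mathbf{R}^n,\ |\xi|\le\alpha}|[\mathcal{F}f](\xi)|.$$
   Context: Functions are complex-valued. $\overline{\mathcal{C}_0}(\mathbf{R}^n)$ is the Banach space of continuous functions on $\mathbf{R}^n$ vanishing at infinity (the completion of the continuous compactly supported functions), with norm $\|F\|=\sup_{\xi\in\mathbf{R}^n}|F(\xi)|$. For $f\in L^1(\mathbf{R}^n)$ (Lebesgue measure), $[\mathcal{F}f](\xi)=\int_{\mathbf{R}^n}e^{-ix\xi}f(x)\,dx$, where $x\xi$ denotes the scalar product, and $[\mathcal{F}L^1](\mathbf{R}^n)=\{\mathcal{F}f:f\in L^1(\mathbf{R}^n)\}$. $|\xi|$ is the Euclidean norm. *)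

theory Defs
  imports "HOL-Analysis.Analysis"
begin

text \<open>
  The type of bounded continuous functions carries the supremum norm, but only real scalar
  multiplication. Complex-linear subspaces are subspaces, in the sense of the locale
  \<^locale>\<open>module\<close>, for the following complex scalar multiplication.
\<close>

definition scaleC_bcontfun ::
    "complex \<Rightarrow> ('a::topological_space \<Rightarrow>\<^sub>C complex) \<Rightarrow> ('a \<Rightarrow>\<^sub>C complex)" where
  "scaleC_bcontfun c F = Bcontfun (\<lambda>x. c * F x)"

lemma apply_scaleC_bcontfun [simp]: "apply_bcontfun (scaleC_bcontfun c F) x = c * F x"
proof -
  obtain b where b: "\<And>x. norm (F x) \<le> b"
    using bounded_apply_bcontfun[of F] by (auto simp: bounded_iff)
  have "norm (c * F x) \<le> norm c * b" for x
    using mult_left_mono[OF b norm_ge_zero] by (simp add: norm_mult)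
  moreover have "continuous_on UNIV (\<lambda>x. c * F x)"
    by (intro continuous_intros) simp
  ultimately have "(\<lambda>x. c * F x) \<in> bcontfun"
    by (rule bcontfun_normI[rotated])
  then show ?thesis
    by (simp add: scaleC_bcontfun_def Bcontfun_inverse)
qed

global_interpretation bcontfunC: vector_space scaleC_bcontfun
  by unfold_locales (auto intro!: bcontfun_eqI simp: algebra_simps)

definition C0 :: "((real ^ 'n::finite) \<Rightarrow>\<^sub>C complex) set" where
  "C0 = {F. (apply_bcontfun F \<longlongrightarrow> 0) at_infinity}"

definition fourier :: "(real ^ 'n::finite \<Rightarrow> complex) \<Rightarrow> real ^ 'n \<Rightarrow> complex" where
  "fourier f \<xi> = (LINT x|lebesgue. exp (- \<i> * complex_of_real (x \<bullet> \<xi>)) * f x)"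

definition FL1 :: "(real ^ 'n::finite \<Rightarrow> complex) set" where
  "FL1 = {fourier f |f. integrable lebesgue f}"

end

theory Submission
  imports Defs
begin

text \<open>
  If the inequality fails for every \<open>\<alpha>\<close> and \<open>C\<close>, then \<open>Y\<close> contains functions of norm \<open>1\<close> that are
  as small as desired on any prescribed ball. Since all functions in \<open>Y\<close> vanish at infinity, such
  functions can be chosen one after the other so that each is small where its predecessors are not
  and vice versa. Their sums, with arbitrary unimodular coefficients, stay bounded by \<open>2\<close>: they
  behave like the unit vectors of the sequence space \<open>c\<^sub>0\<close>. The space \<open>L\<^sup>1\<close> does not tolerate this: in it
  some unimodular \<open>c\<close> satisfies \<open>\<parallel>f + c g\<parallel>\<^sup>2 \<ge> \<parallel>f\<parallel>\<^sup>2 + \<parallel>g\<parallel>\<^sup>2 / 4\<close> (\<open>L1_rotation_gain\<close>), so with a suitable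
  choice of the coefficients the inverse transforms of the sums are unbounded in \<open>L\<^sup>1\<close>
  (\<open>gliding_hump\<close>).

  This contradicts the boundedness of the inverse transform \<open>Y \<rightarrow> L\<^sup>1\<close>, which is the open mapping
  theorem for a closed subspace \<open>Y\<close> of the range. Its proof by Baire category and successive
  approximation yields some preimage of controlled norm (\<open>bounded_fourier_inverse\<close>); to know that it is the
  preimage already constructed, the transform must be injective. That is essential: quotients of
  \<open>L\<^sup>1\<close> may well contain \<open>c\<^sub>0\<close>.

  Injectivity (\<open>fourier_eq_0_imp_AE_0\<close>) comes from the bounded Borel functions that multiply the
  kernel of the transform into itself. They form an algebra closed under bounded pointwise limits.
  It contains the characters, hence the sines of linear functions, hence indicators of half-spaces
  by polynomial approximation, hence the indicators of all Borel sets. So a function with vanishing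
  transform has integral \<open>0\<close> over every Borel set.
\<close>

section \<open>Elementary properties of the transform\<close>

lemma integrable_bounded_mult:
  fixes f g :: "real ^ 'n::finite \<Rightarrow> complex"
  assumes f: "integrable lebesgue f" and g: "g \<in> borel_measurable borel"
    and B: "\<And>x. cmod (g x) \<le> B"
  shows "integrable lebesgue (\<lambda>x. g x * f x)"
proof (rule Bochner_Integration.integrable_bound)
  show "integrable lebesgue (\<lambda>x. of_real B * f x)" using f by simp
  have "g \<in> borel_measurable lebesgue" using g by (simp add: measurable_completion)
  then show "(\<lambda>x. g x * f x) \<in> borel_measurable lebesgue" using f by measurable
  have "norm (g x * f x) \<le> norm (of_real B * f x)" for x
  proof -
    have "cmod (g x) \<le> \<bar>B\<bar>" using B[of x] by linarith
    then show ?thesis by (simp add: norm_mult mult_right_mono)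
  qed
  then show "AE x in lebesgue. norm (g x * f x) \<le> norm (of_real B * f x)" by simp
qed

lemma borel_measurable_character:
  "(\<lambda>x. exp (- \<i> * complex_of_real (x \<bullet> \<xi>))) \<in> borel_measurable (borel :: (real ^ 'n::finite) measure)"
  by (intro borel_measurable_continuous_onI continuous_intros)

lemma norm_character: "cmod (exp (- \<i> * complex_of_real t)) = 1"
  using norm_exp_i_times[of "- t"] by simp

lemma integrable_character_mult:
  fixes f :: "real ^ 'n::finite \<Rightarrow> complex"
  assumes "integrable lebesgue f"
  shows "integrable lebesgue (\<lambda>x. exp (- \<i> * complex_of_real (x \<bullet> \<xi>)) * f x)"
  by (rule integrable_bounded_mult[where B=1, OF assms borel_measurable_character])
    (simp only: norm_character order.refl)

lemma fourier_add:
  assumes "integrable lebesgue f" "integrable lebesgue g"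
  shows "fourier (\<lambda>x. f x + g x) \<xi> = fourier f \<xi> + fourier g \<xi>"
  using integrable_character_mult[OF assms(1)] integrable_character_mult[OF assms(2)]
  by (simp add: fourier_def distrib_left)

lemma fourier_diff:
  assumes "integrable lebesgue f" "integrable lebesgue g"
  shows "fourier (\<lambda>x. f x - g x) \<xi> = fourier f \<xi> - fourier g \<xi>"
  using integrable_character_mult[OF assms(1)] integrable_character_mult[OF assms(2)]
  by (simp add: fourier_def right_diff_distrib)

lemma fourier_cmult: "fourier (\<lambda>x. c * f x) \<xi> = c * fourier f \<xi>"
proof -
  have "fourier (\<lambda>x. c * f x) \<xi> = (LINT x|lebesgue. c * (exp (- \<i> * complex_of_real (x \<bullet> \<xi>)) * f x))"
    unfolding fourier_def by (intro Bochner_Integration.integral_cong) (auto simp: mult_ac)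
  then show ?thesis by (simp add: fourier_def)
qed

lemma fourier_zero: "fourier (\<lambda>x. 0) \<xi> = 0"
  by (simp add: fourier_def)

lemma norm_fourier_le:
  "cmod (fourier f \<xi>) \<le> (LINT x|lebesgue. cmod (f x))"
proof -
  have "cmod (fourier f \<xi>) \<le> (LINT x|lebesgue. cmod (exp (- \<i> * complex_of_real (x \<bullet> \<xi>)) * f x))"
    unfolding fourier_def by (rule integral_norm_bound)
  then show ?thesis by (simp only: norm_mult norm_character mult_1)
qed

section \<open>Injectivity of the transform\<close>

text \<open>
  The multipliers act on all functions with vanishing transform, not on a single one: this is what
  makes the set closed under products.
\<close>

definition null_multiplier :: "(real ^ 'n::finite \<Rightarrow> complex) set" where
  "null_multiplier = {g \<in> borel_measurable borel. (\<exists>B. \<forall>x. cmod (g x) \<le> B) \<and>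
     (\<forall>f. integrable lebesgue f \<longrightarrow> (\<forall>\<xi>. fourier f \<xi> = 0) \<longrightarrow>
        (\<forall>\<xi>. fourier (\<lambda>x. g x * f x) \<xi> = 0))}"

lemma null_multiplier_integrable:
  assumes "g \<in> null_multiplier" "integrable lebesgue f"
  shows "integrable lebesgue (\<lambda>x. g x * f x)"
  using assms integrable_bounded_mult unfolding null_multiplier_def by blast

lemma null_multiplierD:
  assumes "g \<in> null_multiplier" "integrable lebesgue f" "\<And>\<xi>. fourier f \<xi> = 0"
  shows "fourier (\<lambda>x. g x * f x) \<xi> = 0"
  using assms unfolding null_multiplier_def by blast

lemma null_multiplier_const: "(\<lambda>x. c) \<in> null_multiplier"
  unfolding null_multiplier_def by (auto simp: fourier_cmult)

lemma null_multiplier_add: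
  assumes "g \<in> null_multiplier" "h \<in> null_multiplier"
  shows "(\<lambda>x. g x + h x) \<in> null_multiplier"
proof -
  obtain B C where "\<And>x. cmod (g x) \<le> B" "\<And>x. cmod (h x) \<le> C"
    using assms unfolding null_multiplier_def by blast
  then have "\<exists>B. \<forall>x. cmod (g x + h x) \<le> B"
    by (meson add_mono norm_triangle_le)
  moreover have "fourier (\<lambda>x. (g x + h x) * f x) \<xi> = 0"
    if "integrable lebesgue f" "\<And>\<xi>. fourier f \<xi> = 0" for f \<xi>
    using fourier_add[OF null_multiplier_integrable[OF assms(1) that(1)]
        null_multiplier_integrable[OF assms(2) that(1)]]
      null_multiplierD[OF assms(1) that] null_multiplierD[OF assms(2) that]
    by (simp add: distrib_right)
  ultimately show ?thesis
    using assms unfolding null_multiplier_def by auto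
qed

lemma null_multiplier_mult:
  assumes "g \<in> null_multiplier" "h \<in> null_multiplier"
  shows "(\<lambda>x. g x * h x) \<in> null_multiplier"
proof -
  obtain B C where B: "\<And>x. cmod (g x) \<le> B" and C: "\<And>x. cmod (h x) \<le> C"
    using assms unfolding null_multiplier_def by blast
  have "cmod (g x * h x) \<le> B * C" for x
    unfolding norm_mult by (rule mult_mono[OF B C order.trans[OF norm_ge_zero B] norm_ge_zero])
  moreover have "fourier (\<lambda>x. (g x * h x) * f x) \<xi> = 0"
    if "integrable lebesgue f" "\<And>\<xi>. fourier f \<xi> = 0" for f \<xi>
    using null_multiplierD[OF assms(1) null_multiplier_integrable[OF assms(2) that(1)]
        null_multiplierD[OF assms(2) that]]
    by (simp add: mult.assoc)
  ultimately show ?thesis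
    using assms unfolding null_multiplier_def by auto
qed

text \<open>
  Dominated convergence, with a constant multiple of \<open>\<bar>f\<bar>\<close> as majorant.
\<close>

lemma null_multiplier_limit:
  fixes g :: "nat \<Rightarrow> real ^ 'n::finite \<Rightarrow> complex"
  assumes g: "\<And>n. g n \<in> null_multiplier" and B: "\<And>n x. cmod (g n x) \<le> B"
    and lim: "\<And>x. (\<lambda>n. g n x) \<longlonglongrightarrow> h x"
  shows "h \<in> null_multiplier"
proof -
  have [measurable]: "g n \<in> borel_measurable borel" for n
    using g unfolding null_multiplier_def by blast
  have h[measurable]: "h \<in> borel_measurable borel"
    by (rule borel_measurable_LIMSEQ_metric[OF _ lim]) simp
  have hB: "cmod (h x) \<le> B" for x
    by (rule LIMSEQ_le_const2[OF tendsto_norm[OF lim]]) (use B in auto)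
  have "fourier (\<lambda>x. h x * f x) \<xi> = 0"
    if f: "integrable lebesgue f" and z: "\<And>\<xi>. fourier f \<xi> = 0" for f \<xi>
  proof -
    define e where "e = (\<lambda>x. exp (- \<i> * complex_of_real (x \<bullet> \<xi>)))"
    have int: "integrable lebesgue (\<lambda>x. e x * (g n x * f x))" for n
      unfolding e_def
      by (rule integrable_character_mult[OF null_multiplier_integrable[OF g f]])
    have inth: "integrable lebesgue (\<lambda>x. e x * (h x * f x))"
      unfolding e_def
      by (rule integrable_character_mult[OF integrable_bounded_mult[OF f h hB]])
    have "(\<lambda>n. LINT x|lebesgue. e x * (g n x * f x)) \<longlonglongrightarrow> (LINT x|lebesgue. e x * (h x * f x))"
    proof (rule integral_dominated_convergence[where w="\<lambda>x. B * cmod (f x)"])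
      show "AE x in lebesgue. (\<lambda>n. e x * (g n x * f x)) \<longlonglongrightarrow> e x * (h x * f x)"
        by (intro AE_I2 tendsto_intros lim)
      show "AE x in lebesgue. norm (e x * (g n x * f x)) \<le> B * cmod (f x)" for n
        unfolding e_def norm_mult norm_character mult_1
        by (intro AE_I2 mult_right_mono B norm_ge_zero)
    qed (use f int inth in \<open>auto intro: borel_measurable_integrable\<close>)
    moreover have "(LINT x|lebesgue. e x * (g n x * f x)) = 0" for n
      using null_multiplierD[OF g f z] by (simp add: fourier_def e_def)
    ultimately show ?thesis
      by (simp add: fourier_def e_def LIMSEQ_const_iff)
  qed
  then show ?thesis using h hB unfolding null_multiplier_def by blast
qed

text \<open>
  Multiplication by a character translates the transform, and the translate of \<open>0\<close> is \<open>0\<close>.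
\<close>

lemma null_multiplier_character:
  fixes \<eta> :: "real ^ 'n::finite"
  shows "(\<lambda>x. exp (- \<i> * complex_of_real (x \<bullet> \<eta>))) \<in> null_multiplier"
proof -
  have "exp (- \<i> * complex_of_real (x \<bullet> (\<xi> + \<eta>))) =
      exp (- \<i> * complex_of_real (x \<bullet> \<xi>)) * exp (- \<i> * complex_of_real (x \<bullet> \<eta>))" for x \<xi> :: "real ^ 'n"
    by (simp only: inner_add_right of_real_add distrib_left exp_add)
  then have "fourier (\<lambda>x. exp (- \<i> * complex_of_real (x \<bullet> \<eta>)) * f x) \<xi> = fourier f (\<xi> + \<eta>)" for f \<xi>
    unfolding fourier_def by (simp only: mult.assoc)
  then show ?thesis
    unfolding null_multiplier_def using borel_measurable_character norm_character
    by (auto intro!: exI[of _ 1] simp del: mult_minus_left)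
qed

lemma null_multiplier_sin:
  fixes \<eta> :: "real ^ 'n::finite"
  shows "(\<lambda>x. complex_of_real (sin (x \<bullet> \<eta> - a))) \<in> null_multiplier"
proof -
  have "complex_of_real (sin (x \<bullet> \<eta> - a)) =
      exp (\<i> * a) / (- 2 * \<i>) * exp (- \<i> * complex_of_real (x \<bullet> \<eta>)) +
      exp (- \<i> * a) / (2 * \<i>) * exp (- \<i> * complex_of_real (x \<bullet> (- \<eta>)))" for x
  proof -
    define t where "t = x \<bullet> \<eta>"
    have "complex_of_real (sin (t - a)) =
        (exp (\<i> * (of_real t - of_real a)) - exp (- (\<i> * (of_real t - of_real a)))) / (2 * \<i>)"
      by (simp only: sin_of_real[symmetric] of_real_diff sin_exp_eq)
    also have "\<i> * (of_real t - of_real a) = - \<i> * complex_of_real (- t) + (- \<i>) * complex_of_real a"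
      by (simp add: algebra_simps)
    also have "- \<dots> = - \<i> * complex_of_real t + \<i> * complex_of_real a"
      by (simp add: algebra_simps)
    finally show ?thesis
      by (simp only: exp_add t_def inner_minus_right) (simp add: field_simps)
  qed
  then show ?thesis
    using null_multiplier_add[OF null_multiplier_mult[OF null_multiplier_const null_multiplier_character[of \<eta>]]
        null_multiplier_mult[OF null_multiplier_const null_multiplier_character[of "- \<eta>"]]]
    by presburger
qed

lemma null_multiplier_polynomial:
  assumes p: "real_polynomial_function p"
    and s: "(\<lambda>x. complex_of_real (s x)) \<in> null_multiplier"
  shows "(\<lambda>x. complex_of_real (p (s x :: real))) \<in> null_multiplier"
  using p
proof induction
  case (linear f)
  have "f t = t * f 1" for t
    using linear_scale[OF bounded_linear.linear[OF linear], of t 1] by simp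
  then have "(\<lambda>x. complex_of_real (f (s x))) = (\<lambda>x. complex_of_real (s x) * complex_of_real (f 1))"
    by (metis of_real_mult)
  then show ?case using null_multiplier_mult[OF s null_multiplier_const] by simp
qed (use null_multiplier_const null_multiplier_add null_multiplier_mult in auto)

text \<open>
  By Weierstrass approximation the indicator of \<open>{t. t > 0}\<close> is the pointwise limit on \<open>{-1..1}\<close> of
  uniformly bounded polynomials \<open>p k\<close>, and \<open>p k \<circ> s\<close> is a multiplier whenever \<open>s\<close> is one.
\<close>

lemma null_multiplier_positive_part:
  assumes s: "(\<lambda>x. complex_of_real (s x)) \<in> null_multiplier" and s1: "\<And>x. \<bar>s x\<bar> \<le> 1"
  shows "(\<lambda>x. complex_of_real (indicator {x. s x > 0} x)) \<in> null_multiplier"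
proof -
  \<comment> \<open>For \<open>k > 0\<close> a continuous ramp from \<open>0\<close> to \<open>1\<close> on \<open>{0..1/k}\<close>; these increase to the indicator.\<close>
  define H where "H = (\<lambda>(k::nat) t::real. min 1 (max 0 (real k * t)))"
  have "\<exists>p. real_polynomial_function p \<and> (\<forall>t\<in>{-1..1}. \<bar>H k t - p t\<bar> < 1 / real (Suc k))" for k
  proof -
    have "continuous_on {-1..1} (H k)"
      unfolding H_def by (intro continuous_intros)
    then show ?thesis
      by (metis Stone_Weierstrass_real_polynomial_function compact_Icc of_nat_0_less_iff
          zero_less_Suc zero_less_divide_1_iff)
  qed
  then obtain p where p: "\<And>k. real_polynomial_function (p k)"
    and pH: "\<And>k t. t \<in> {-1..1} \<Longrightarrow> \<bar>H k t - p k t\<bar> < 1 / real (Suc k)"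
    by metis
  have sI: "s x \<in> {-1..1}" for x using s1[of x] by (auto simp: abs_le_iff)
  show ?thesis
  proof (rule null_multiplier_limit)
    show "(\<lambda>x. complex_of_real (p k (s x))) \<in> null_multiplier" for k
      by (rule null_multiplier_polynomial[OF p s])
    show "cmod (complex_of_real (p k (s x))) \<le> 2" for k x
    proof -
      have "\<bar>H k (s x)\<bar> \<le> 1" by (auto simp: H_def)
      moreover have "1 / real (Suc k) \<le> 1" by simp
      ultimately show ?thesis unfolding norm_of_real using pH[OF sI, of k x] by linarith
    qed
    have H: "(\<lambda>k. H k (s x)) \<longlonglongrightarrow> indicator {x. s x > 0} x" for x
    proof (cases "s x > 0")
      case True
      obtain N :: nat where N: "1 / s x < real N" using reals_Archimedean2 by blast
      have "H k (s x) = 1" if "k \<ge> N" for k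
      proof -
        have "1 / s x \<le> real k" using N that by (meson less_le_trans less_imp_le of_nat_le_iff)
        then have "1 \<le> real k * s x" using True by (simp add: field_simps)
        then show ?thesis by (simp add: H_def)
      qed
      then show ?thesis using True
        by (intro tendsto_eventually) (auto simp: eventually_sequentially)
    next
      case False
      then have "real k * s x \<le> 0" for k by (simp add: mult_nonneg_nonpos)
      then have "H k (s x) = 0" for k by (simp add: H_def max_absorb1)
      then show ?thesis using False by simp
    qed
    have "(\<lambda>k. H k (s x) - p k (s x)) \<longlonglongrightarrow> 0" for x
    proof (rule Lim_null_comparison)
      show "\<forall>\<^sub>F k in sequentially. norm (H k (s x) - p k (s x)) \<le> 1 / real (Suc k)"
        using pH[OF sI] by (intro always_eventually allI) (simp add: less_imp_le)
      show "(\<lambda>k. 1 / real (Suc k)) \<longlonglongrightarrow> 0"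
        using LIMSEQ_inverse_real_of_nat by (simp add: inverse_eq_divide)
    qed
    then have "(\<lambda>k. H k (s x) - (H k (s x) - p k (s x))) \<longlonglongrightarrow> indicator {x. s x > 0} x - 0" for x
      by (intro tendsto_diff H)
    then show "(\<lambda>k. complex_of_real (p k (s x))) \<longlonglongrightarrow> complex_of_real (indicator {x. s x > 0} x)" for x
      by (intro tendsto_of_real) simp
  qed
qed

text \<open>
  The multiplier \<open>sin ((x \<bullet> b - a) / k)\<close> has the sign of \<open>x \<bullet> b - a\<close> as long as \<open>\<bar>x \<bullet> b - a\<bar> < k \<pi>\<close>. As \<open>k\<close> grows, this covers every point \<open>x\<close>.
\<close>

lemma null_multiplier_halfspace:
  fixes b :: "real ^ 'n::finite"
  shows "(\<lambda>x. complex_of_real (indicator {x. a < x \<bullet> b} x)) \<in> null_multiplier"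
proof (rule null_multiplier_limit)
  let ?s = "\<lambda>k x. sin (x \<bullet> (b /\<^sub>R real (Suc k)) - a / real (Suc k))"
  show "(\<lambda>x. complex_of_real (indicator {x. ?s k x > 0} x)) \<in> null_multiplier" for k
    by (rule null_multiplier_positive_part[OF null_multiplier_sin]) simp
  show "cmod (complex_of_real (indicator {x. ?s k x > 0} x)) \<le> 1" for k x
    by (simp add: indicator_def)
  show "(\<lambda>k. complex_of_real (indicator {x. ?s k x > 0} x)) \<longlonglongrightarrow>
      complex_of_real (indicator {x. a < x \<bullet> b} x)" for x
  proof -
    obtain N :: nat where N: "\<bar>x \<bullet> b - a\<bar> < real N" using reals_Archimedean2 by blast
    have "(0 < ?s k x) \<longleftrightarrow> a < x \<bullet> b" if "k \<ge> N" for k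
    proof -
      define t where "t = (x \<bullet> b - a) / real (Suc k)"
      have eq: "?s k x = sin t"
        by (simp add: t_def divide_simps del: of_nat_Suc)
      have "real N \<le> real (Suc k)" using that by simp
      with N have "\<bar>x \<bullet> b - a\<bar> < real (Suc k)" by linarith
      then have "\<bar>t\<bar> < 1" by (simp add: t_def abs_divide del: of_nat_Suc)
      then have t: "\<bar>t\<bar> < pi" using pi_gt3 by linarith
      have "0 < sin t \<longleftrightarrow> 0 < t"
      proof (cases "0 < t")
        case True then show ?thesis using t sin_gt_zero[of t] by simp
      next
        case False
        then have "0 \<le> sin (- t)" using t by (intro sin_ge_zero) auto
        then show ?thesis using False by simp
      qed
      also have "\<dots> \<longleftrightarrow> a < x \<bullet> b" by (simp add: t_def zero_less_divide_iff del: of_nat_Suc)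
      finally show ?thesis unfolding eq .
    qed
    then show ?thesis
      by (intro tendsto_eventually) (auto simp: eventually_sequentially indicator_def intro!: exI[of _ N])
  qed
qed

text \<open>
  The sets whose indicators are multipliers form a \<open>\<sigma>\<close>-algebra, because the multipliers are an algebra
  closed under bounded pointwise limits, and half-spaces generate the Borel sets.
\<close>

lemma null_multiplier_borel:
  fixes A :: "(real ^ 'n::finite) set"
  assumes "A \<in> sets borel"
  shows "(\<lambda>x. complex_of_real (indicator A x)) \<in> null_multiplier"
proof -
  have A: "A \<in> sigma_sets UNIV ((\<lambda>(a, i). {x::real ^ 'n. a < x \<bullet> i}) ` (UNIV \<times> Basis))"
    using assms unfolding borel_eq_halfspace_greater by simp
  have compl: "(\<lambda>x. complex_of_real (indicator (- S) x)) \<in> null_multiplier"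
    if "(\<lambda>x. complex_of_real (indicator S x)) \<in> null_multiplier" for S :: "(real ^ 'n) set"
  proof -
    have "(\<lambda>x. complex_of_real (indicator (- S) x)) =
        (\<lambda>x. 1 + (-1) * complex_of_real (indicator S x))"
      by (auto simp: indicator_def)
    then show ?thesis
      using null_multiplier_add[OF null_multiplier_const
          null_multiplier_mult[OF null_multiplier_const that]] by presburger
  qed
  show ?thesis
    using A
  proof induction
    case (Basic S)
    then show ?case using null_multiplier_halfspace by auto
  next
    case Empty
    then show ?case using null_multiplier_const[of 0] by simp
  next
    case (Compl S)
    then show ?case using compl[of S] by (simp add: Compl_eq_Diff_UNIV)
  next
    case (Union S)
    \<comment> \<open>Finite unions are complements of finite intersections, and intersection is multiplication.\<close>
    have inter: "(\<lambda>x. complex_of_real (indicator (\<Inter>i<n. - S i) x)) \<in> null_multiplier" for n :: nat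
    proof (induction n)
      case 0
      then show ?case using null_multiplier_const[of 1] by simp
    next
      case (Suc n)
      have "(\<lambda>x. complex_of_real (indicator (\<Inter>i<Suc n. - S i) x)) =
        (\<lambda>x. complex_of_real (indicator (- S n) x) * complex_of_real (indicator (\<Inter>i<n. - S i) x))"
        by (auto simp: indicator_def lessThan_Suc fun_eq_iff)
      then show ?case
        using null_multiplier_mult[OF compl[OF Union.IH] Suc] by presburger
    qed
    have un: "(\<lambda>x. complex_of_real (indicator (\<Union>i<n. S i) x)) \<in> null_multiplier" for n :: nat
      using compl[OF inter[of n]] by (simp add: Compl_INT)
    show ?case
    proof (rule null_multiplier_limit[OF un])
      show "cmod (complex_of_real (indicator (\<Union>i<n. S i) x)) \<le> 1" for n x
        by (simp add: indicator_def)
      show "(\<lambda>n. complex_of_real (indicator (\<Union>i<n. S i) x)) \<longlonglongrightarrow>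
          complex_of_real (indicator (\<Union> (range S)) x)" for x
        by (intro tendsto_of_real LIMSEQ_indicator_UN)
    qed
  qed
qed

lemma sigma_finite_lebesgue: "sigma_finite_measure (lebesgue :: 'a::euclidean_space measure)"
proof
  show "\<exists>A::'a set set. countable A \<and> A \<subseteq> sets lebesgue \<and> \<Union>A = space lebesgue \<and>
      (\<forall>a\<in>A. emeasure lebesgue a \<noteq> \<infinity>)"
  proof (intro exI conjI ballI)
    show "\<Union>(range (\<lambda>n. cball (0::'a) (real n))) = space lebesgue"
      by (auto simp: real_arch_simple)
    fix a assume "a \<in> range (\<lambda>n. cball (0::'a) (real n))"
    then have "a \<in> lmeasurable" by (auto intro: lmeasurable_cball)
    then show "emeasure lebesgue a \<noteq> \<infinity>" using fmeasurableD2[of a lebesgue] by (simp only: infinity_ennreal_def not_False_eq_True simp_thms)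
  qed auto
qed

text \<open>
  The integral of \<open>f\<close> over a Borel set \<open>S\<close> is the transform of \<open>1\<^sub>S f\<close> at \<open>0\<close>, which vanishes as \<open>1\<^sub>S\<close>
  is a multiplier. Lebesgue sets differ from Borel sets by null sets.
\<close>

lemma fourier_eq_0_imp_AE_0:
  fixes f :: "real ^ 'n::finite \<Rightarrow> complex"
  assumes f: "integrable lebesgue f" and z: "\<And>\<xi>. fourier f \<xi> = 0"
  shows "AE x in lebesgue. f x = 0"
proof (rule sigma_finite_measure.density_zero[OF sigma_finite_lebesgue f])
  fix A :: "(real ^ 'n) set" assume A: "A \<in> sets lebesgue"
  obtain S N N' where A_eq: "A = S \<union> N" and N: "N \<subseteq> N'" "N' \<in> null_sets lborel" and S: "S \<in> sets lborel"
    using sets_completionE[OF A] by metis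
  have "N' \<in> null_sets lebesgue" using N(2) by (rule null_sets_completionI)
  then have "AE x in lebesgue. x \<notin> N'" by (rule AE_not_in)
  then have ae: "AE x in lebesgue. indicator A x *\<^sub>R f x = indicator S x *\<^sub>R f x"
    by eventually_elim (use A_eq N in \<open>auto simp: indicator_def\<close>)
  have "S \<in> sets lebesgue" using S by (simp add: sets_completionI_sets)
  then have "(LINT x|lebesgue. indicator A x *\<^sub>R f x) = (LINT x|lebesgue. indicator S x *\<^sub>R f x)"
    using A f borel_measurable_integrable[OF f]
    by (intro integral_cong_AE ae borel_measurable_scaleR borel_measurable_indicator) auto
  also have "\<dots> = fourier (\<lambda>x. complex_of_real (indicator S x) * f x) 0"
    by (simp add: fourier_def scaleR_conv_of_real)
  also have "\<dots> = 0"
    using null_multiplierD[OF null_multiplier_borel f z] S by simp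
  finally show "set_lebesgue_integral lebesgue A f = 0"
    by (simp add: set_lebesgue_integral_def)
qed

lemma L1_norm_eq_if_fourier_eq:
  assumes "integrable lebesgue f" "integrable lebesgue g" "fourier f = fourier g"
  shows "(LINT x|lebesgue. cmod (f x)) = (LINT x|lebesgue. cmod (g x))"
proof (rule integral_cong_AE)
  have "AE x in lebesgue. f x - g x = 0"
    using assms by (intro fourier_eq_0_imp_AE_0) (auto simp: fourier_diff)
  then show "AE x in lebesgue. cmod (f x) = cmod (g x)" by eventually_elim simp
qed (use assms in auto)

section \<open>Bounded inversion on closed subspaces\<close>

text \<open>
  This lemma and the next two express that absolutely convergent series converge in \<open>L\<^sup>1\<close>, and that the
  transform may be applied to them term by term. This completeness turns successive approximation
  into an exact preimage.
\<close>

lemma AE_summable_if_summable_L1_norm: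
  fixes f :: "nat \<Rightarrow> 'a \<Rightarrow> 'b::{banach, second_countable_topology}"
  assumes f: "\<And>i. integrable M (f i)" and s: "summable (\<lambda>i. LINT x|M. norm (f i x))"
  shows "AE x in M. summable (\<lambda>i. norm (f i x))"
proof -
  have [measurable]: "f i \<in> borel_measurable M" for i using f by auto
  have "(\<integral>\<^sup>+x. (\<Sum>i. ennreal (norm (f i x))) \<partial>M) = (\<Sum>i. ennreal (LINT x|M. norm (f i x)))"
    using f by (subst nn_integral_suminf) (simp_all add: nn_integral_eq_integral)
  also have "\<dots> = ennreal (\<Sum>i. LINT x|M. norm (f i x))"
    by (rule suminf_ennreal2[OF _ s]) simp
  also have "\<dots> \<noteq> \<infinity>" by simp
  finally have "AE x in M. (\<Sum>i. ennreal (norm (f i x))) \<noteq> \<infinity>"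
    by (intro nn_integral_PInf_AE) auto
  then show ?thesis
    by eventually_elim (auto intro: summable_suminf_not_top)
qed

lemma L1_norm_suminf_le:
  fixes f :: "nat \<Rightarrow> 'a \<Rightarrow> 'b::{banach, second_countable_topology}"
  assumes f: "\<And>i. integrable M (f i)" and s: "summable (\<lambda>i. LINT x|M. norm (f i x))"
  shows "(LINT x|M. norm (\<Sum>i. f i x)) \<le> (\<Sum>i. LINT x|M. norm (f i x))"
proof -
  note ae = AE_summable_if_summable_L1_norm[OF f s]
  have "(LINT x|M. norm (\<Sum>i. f i x)) \<le> (LINT x|M. (\<Sum>i. norm (f i x)))"
  proof (rule integral_mono_AE)
    show "integrable M (\<lambda>x. norm (\<Sum>i. f i x))"
      by (intro integrable_norm integrable_suminf f s ae)
    show "integrable M (\<lambda>x. \<Sum>i. norm (f i x))"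
      by (rule integrable_suminf) (use f s ae in auto)
    show "AE x in M. norm (\<Sum>i. f i x) \<le> (\<Sum>i. norm (f i x))"
      using ae by eventually_elim (rule summable_norm)
  qed
  also have "\<dots> = (\<Sum>i. LINT x|M. norm (f i x))"
    by (rule integral_suminf) (use f s ae in auto)
  finally show ?thesis .
qed

lemma fourier_sums:
  fixes f :: "nat \<Rightarrow> real ^ 'n::finite \<Rightarrow> complex"
  assumes f: "\<And>i. integrable lebesgue (f i)" and s: "summable (\<lambda>i. LINT x|lebesgue. cmod (f i x))"
  shows "(\<lambda>i. fourier (f i) \<xi>) sums fourier (\<lambda>x. \<Sum>i. f i x) \<xi>"
proof -
  define e where "e = (\<lambda>x. exp (- \<i> * complex_of_real (x \<bullet> \<xi>)))"
  have e: "cmod (e x * z) = cmod z" for x z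
    unfolding e_def norm_mult norm_character by simp
  note ae = AE_summable_if_summable_L1_norm[OF f s]
  have int: "integrable lebesgue (\<lambda>x. e x * f i x)" for i
    unfolding e_def by (rule integrable_character_mult[OF f])
  have "(\<lambda>i. LINT x|lebesgue. e x * f i x) sums (LINT x|lebesgue. (\<Sum>i. e x * f i x))"
    by (rule sums_integral) (use int ae s in \<open>auto simp: e\<close>)
  also have "(LINT x|lebesgue. (\<Sum>i. e x * f i x)) = (LINT x|lebesgue. e x * (\<Sum>i. f i x))"
  proof (rule integral_cong_AE)
    have "integrable lebesgue (\<lambda>x. \<Sum>i. e x * f i x)"
      by (rule integrable_suminf) (use int ae s in \<open>auto simp: e\<close>)
    then show "(\<lambda>x. \<Sum>i. e x * f i x) \<in> borel_measurable lebesgue" by auto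
    have "integrable lebesgue (\<lambda>x. e x * (\<Sum>i. f i x))"
      unfolding e_def by (intro integrable_character_mult integrable_suminf f s ae)
    then show "(\<lambda>x. e x * (\<Sum>i. f i x)) \<in> borel_measurable lebesgue" by auto
    show "AE x in lebesgue. (\<Sum>i. e x * f i x) = e x * (\<Sum>i. f i x)"
      using ae by eventually_elim (rule suminf_mult[OF summable_norm_cancel])
  qed
  finally show ?thesis by (simp add: fourier_def e_def)
qed

text \<open>
  The Baire category half of the open mapping theorem. Let \<open>Q m\<close> consist of the functions in \<open>Y\<close> with a
  preimage of norm at most \<open>m\<close>. These sets exhaust \<open>Y\<close>, so the closure of one of them contains a ball
  of \<open>Y\<close> around some \<open>F0\<close>. A multiple \<open>s F\<close> that fits into the ball of radius \<open>r\<close> is the difference of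
  \<open>F0 + s F\<close> and \<open>F0\<close>, both of which are approximated from \<open>Q m\<close>; the remainder \<open>G\<close> is what the
  approximation misses.
\<close>

lemma approximate_fourier_inverse:
  fixes Y :: "((real ^ 'n::finite) \<Rightarrow>\<^sub>C complex) set"
  assumes sub: "subspace Y" and cl: "closed Y" and FL: "apply_bcontfun ` Y \<subseteq> FL1"
  shows "\<exists>M\<ge>0. \<forall>F\<in>Y. \<exists>f. \<exists>G\<in>Y. integrable lebesgue f \<and> (\<forall>\<xi>. fourier f \<xi> = apply_bcontfun F \<xi> - apply_bcontfun G \<xi>) \<and>
    (LINT x|lebesgue. cmod (f x)) \<le> M * norm F \<and> norm G \<le> norm F / 2"
proof -
  define Q where "Q = (\<lambda>m::nat. {F\<in>Y. \<exists>f. integrable lebesgue f \<and>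
      apply_bcontfun F = fourier f \<and> (LINT x|lebesgue. cmod (f x)) \<le> real m})"
  have Qcl: "closure (Q m) \<subseteq> Y" for m
    by (rule closure_minimal[OF _ cl]) (auto simp: Q_def)
  have "Y \<subseteq> (\<Union>m. closure (Q m))"
  proof
    fix F assume F: "F \<in> Y"
    then obtain f where f: "integrable lebesgue f" "apply_bcontfun F = fourier f"
      using FL unfolding FL1_def by blast
    obtain m :: nat where "(LINT x|lebesgue. cmod (f x)) \<le> real m" using real_arch_simple by blast
    with F f have "F \<in> Q m" unfolding Q_def by blast
    then show "F \<in> (\<Union>m. closure (Q m))" using closure_subset by blast
  qed
  with Qcl have un: "\<Union>(range (\<lambda>m. closure (Q m))) = Y" by blast
  have "\<exists>m. top_of_set Y interior_of closure (Q m) \<noteq> {}"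
  proof (rule ccontr)
    assume "\<not> ?thesis"
    then have "top_of_set Y interior_of \<Union>(range (\<lambda>m. closure (Q m))) = {}"
      using Qcl cl
      by (intro Baire_category_alt disjI1 completely_metrizable_space_closedin
          completely_metrizable_space_euclidean)
        (auto simp: closedin_closed_eq[OF cl])
    then have "Y = {}"
      using interior_of_topspace[of "top_of_set Y"] un by simp
    then show False using subspace_0[OF sub] by simp
  qed
  then obtain m F0 where F0: "F0 \<in> top_of_set Y interior_of closure (Q m)" by blast
  then obtain r where r: "r > 0" and ball: "ball F0 r \<inter> Y \<subseteq> closure (Q m)"
    using openin_contains_ball[of Y "top_of_set Y interior_of closure (Q m)"]
      interior_of_subset[of "top_of_set Y" "closure (Q m)"] by fastforce
  have F0Y: "F0 \<in> Y" using F0 interior_of_subset_topspace by fastforce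
  have "\<exists>f. \<exists>G\<in>Y. integrable lebesgue f \<and> (\<forall>\<xi>. fourier f \<xi> = apply_bcontfun F \<xi> - apply_bcontfun G \<xi>) \<and>
      (LINT x|lebesgue. cmod (f x)) \<le> 4 * real m / r * norm F \<and> norm G \<le> norm F / 2"
    if F: "F \<in> Y" for F
  proof (cases "F = 0")
    case True
    then show ?thesis
      by (intro exI[of _ "\<lambda>x. 0"] bexI[of _ 0]) (auto simp: fourier_zero subspace_0[OF sub])
  next
    case False
    \<comment> \<open>With this scaling the total error \<open>r / 4\<close> below is half of \<open>norm (s F)\<close>.\<close>
    define s where "s = r / (2 * norm F)"
    have s: "s > 0" using False r by (simp add: s_def)
    have "norm (s *\<^sub>R F) < r" using False r by (simp add: s_def)
    moreover have "F0 + s *\<^sub>R F \<in> Y"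
      by (intro subspace_add[OF sub] subspace_scale[OF sub] F F0Y)
    ultimately have "F0 + s *\<^sub>R F \<in> closure (Q m)" "F0 \<in> closure (Q m)"
      using ball F0Y r by (auto simp: dist_norm)
    then obtain A B where A: "A \<in> Q m" "dist A (F0 + s *\<^sub>R F) < r / 8"
      and B: "B \<in> Q m" "dist B F0 < r / 8"
      using r unfolding closure_approachable by (metis divide_pos_pos zero_less_numeral)
    obtain a where a: "integrable lebesgue a" "apply_bcontfun A = fourier a"
        "(LINT x|lebesgue. cmod (a x)) \<le> real m"
      using A unfolding Q_def by blast
    obtain b where b: "integrable lebesgue b" "apply_bcontfun B = fourier b"
        "(LINT x|lebesgue. cmod (b x)) \<le> real m"
      using B unfolding Q_def by blast
    define f where "f = (\<lambda>x. complex_of_real (inverse s) * (a x - b x))"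
    define G where "G = F - (A - B) /\<^sub>R s"
    have "A \<in> Y" "B \<in> Y" using A B unfolding Q_def by auto
    then have "G \<in> Y" unfolding G_def
      by (intro subspace_diff[OF sub] subspace_scale[OF sub] F)
    moreover have "integrable lebesgue f" unfolding f_def using a b by simp
    moreover have "fourier f \<xi> = apply_bcontfun F \<xi> - apply_bcontfun G \<xi>" for \<xi>
      unfolding f_def G_def fourier_cmult fourier_diff[OF a(1) b(1)]
      by (simp add: a(2)[symmetric] b(2)[symmetric] scaleR_conv_of_real)
    moreover have "(LINT x|lebesgue. cmod (f x)) \<le> 4 * real m / r * norm F"
    proof -
      have "(LINT x|lebesgue. cmod (a x - b x)) \<le> (LINT x|lebesgue. cmod (a x) + cmod (b x))"
        using a b by (intro integral_mono norm_triangle_ineq4) auto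
      also have "\<dots> \<le> 2 * real m" using a b by simp
      finally have "inverse s * (LINT x|lebesgue. cmod (a x - b x)) \<le> inverse s * (2 * real m)"
        using s by (intro mult_left_mono) auto
      moreover have "(LINT x|lebesgue. cmod (f x)) = inverse s * (LINT x|lebesgue. cmod (a x - b x))"
        using s by (simp add: f_def norm_mult norm_inverse)
      moreover have "inverse s * (2 * real m) = 4 * real m / r * norm F"
        using r False by (simp add: s_def field_simps)
      ultimately show ?thesis by simp
    qed
    moreover have "norm G \<le> norm F / 2"
    proof -
      have "s *\<^sub>R G = (F0 + s *\<^sub>R F - A) + (B - F0)"
        using s by (simp add: G_def algebra_simps)
      then have "norm (s *\<^sub>R G) \<le> r / 8 + r / 8"
        using A(2) B(2) norm_triangle_ineq[of "F0 + s *\<^sub>R F - A" "B - F0"]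
        by (simp add: dist_norm norm_minus_commute)
      then show ?thesis using s r False by (simp add: s_def field_simps)
    qed
    ultimately show ?thesis by blast
  qed
  then show ?thesis using r by (intro exI[of _ "4 * real m / r"]) auto
qed

text \<open>
  The remainder of the approximate inversion is again in \<open>Y\<close> and at most half as large, so iteration
  gives preimages of the successive remainders \<open>D n\<close> with geometrically decreasing norms. Their sum is a
  preimage of \<open>F\<close>, since the sum of the transforms telescopes.
\<close>

lemma bounded_fourier_inverse:
  fixes Y :: "((real ^ 'n::finite) \<Rightarrow>\<^sub>C complex) set"
  assumes sub: "subspace Y" and cl: "closed Y" and FL: "apply_bcontfun ` Y \<subseteq> FL1"
  shows "\<exists>K\<ge>0. \<forall>F\<in>Y. \<exists>f. integrable lebesgue f \<and> apply_bcontfun F = fourier f \<and>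
    (LINT x|lebesgue. cmod (f x)) \<le> K * norm F"
proof -
  obtain M where M: "M \<ge> 0" and "\<forall>F\<in>Y. \<exists>f. \<exists>G\<in>Y. integrable lebesgue f \<and>
      (\<forall>\<xi>. fourier f \<xi> = apply_bcontfun F \<xi> - apply_bcontfun G \<xi>) \<and>
      (LINT x|lebesgue. cmod (f x)) \<le> M * norm F \<and> norm G \<le> norm F / 2"
    using approximate_fourier_inverse[OF assms] by blast
  then obtain \<phi> \<gamma> where \<phi>: "\<And>F. F \<in> Y \<Longrightarrow> integrable lebesgue (\<phi> F)"
      and \<gamma>: "\<And>F. F \<in> Y \<Longrightarrow> \<gamma> F \<in> Y"
      and eq: "\<And>F \<xi>. F \<in> Y \<Longrightarrow> fourier (\<phi> F) \<xi> = apply_bcontfun F \<xi> - apply_bcontfun (\<gamma> F) \<xi>"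
      and \<phi>M: "\<And>F. F \<in> Y \<Longrightarrow> (LINT x|lebesgue. cmod (\<phi> F x)) \<le> M * norm F"
      and \<gamma>2: "\<And>F. F \<in> Y \<Longrightarrow> norm (\<gamma> F) \<le> norm F / 2"
    by metis
  have "\<exists>f. integrable lebesgue f \<and> apply_bcontfun F = fourier f \<and>
      (LINT x|lebesgue. cmod (f x)) \<le> (2 * M) * norm F" if F: "F \<in> Y" for F
  proof -
    define D where "D = (\<lambda>n. (\<gamma> ^^ n) F)"
    define f where "f = (\<lambda>n. \<phi> (D n))"
    have DY: "D n \<in> Y" for n by (induction n) (auto simp: D_def F \<gamma>)
    have Dn: "norm (D n) \<le> norm F * (1/2) ^ n" for n
    proof (induction n)
      case (Suc n)
      have "norm (D (Suc n)) \<le> norm (D n) / 2" using \<gamma>2[OF DY[of n]] by (simp add: D_def)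
      with Suc show ?case by simp
    qed (simp add: D_def)
    have fint: "integrable lebesgue (f n)" for n unfolding f_def by (rule \<phi>[OF DY])
    have fn: "(LINT x|lebesgue. cmod (f n x)) \<le> M * norm F * (1/2) ^ n" for n
      using order.trans[OF \<phi>M[OF DY] mult_left_mono[OF Dn M]] by (simp add: f_def mult_ac)
    have geo: "(\<lambda>n. M * norm F * (1/2) ^ n) sums (M * norm F * 2)"
      using sums_mult[OF geometric_sums[of "1/2::real"], of "M * norm F"] by simp
    have summ: "summable (\<lambda>n. LINT x|lebesgue. cmod (f n x))"
      by (rule summable_comparison_test'[OF sums_summable[OF geo], of 0]) (use fn in auto)
    define g where "g = (\<lambda>x. \<Sum>i. f i x)"
    have g: "integrable lebesgue g"
      unfolding g_def by (intro integrable_suminf fint summ AE_summable_if_summable_L1_norm)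
    have "(LINT x|lebesgue. cmod (g x)) \<le> (\<Sum>n. LINT x|lebesgue. cmod (f n x))"
      unfolding g_def by (rule L1_norm_suminf_le[OF fint summ])
    also have "\<dots> \<le> M * norm F * 2"
      using suminf_le[OF fn summ sums_summable[OF geo]] sums_unique[OF geo] by simp
    finally have gn: "(LINT x|lebesgue. cmod (g x)) \<le> (2 * M) * norm F" by (simp add: mult_ac)
    have "apply_bcontfun F \<xi> = fourier g \<xi>" for \<xi>
    proof -
      have partial: "(\<Sum>i<n. fourier (f i) \<xi>) = F \<xi> - D n \<xi>" for n
        by (induction n) (simp_all add: f_def eq[OF DY], simp_all add: D_def)
      have "(\<lambda>n. D n \<xi>) \<longlonglongrightarrow> 0"
      proof (rule Lim_null_comparison)
        show "\<forall>\<^sub>F n in sequentially. norm (D n \<xi>) \<le> norm F * (1/2) ^ n"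
          by (intro always_eventually allI order.trans[OF norm_bounded Dn])
        show "(\<lambda>n. norm F * (1/2) ^ n) \<longlonglongrightarrow> 0"
          by (intro tendsto_mult_right_zero LIMSEQ_power_zero) simp
      qed
      then have "(\<lambda>n. F \<xi> - D n \<xi>) \<longlonglongrightarrow> F \<xi> - 0" by (intro tendsto_intros)
      then have "(\<lambda>i. fourier (f i) \<xi>) sums F \<xi>"
        unfolding sums_def partial by simp
      then show ?thesis
        using fourier_sums[OF fint summ] sums_unique2 unfolding g_def by blast
    qed
    with g gn show ?thesis by blast
  qed
  then show ?thesis using M by (intro exI[of _ "2 * M"]) auto
qed

section \<open>Rotations in the space of integrable functions\<close>

text \<open>
  For real coefficients \<open>\<plusminus>1\<close> nothing is gained when \<open>a\<close> and \<open>b\<close> are parallel with \<open>\<bar>b\<bar> \<le> \<bar>a\<bar>\<close>, but then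
  \<open>\<i> b\<close> is orthogonal to \<open>a\<close> and the coefficients \<open>\<plusminus>\<i>\<close> gain. Quantitatively, the sum \<open>s\<close> over \<open>\<plusminus>b\<close> and
  the sum \<open>t\<close> over \<open>\<plusminus>\<i> b\<close> satisfy \<open>s\<^sup>2 + t\<^sup>2 \<ge> 8 \<bar>a\<bar>\<^sup>2 + 4 \<bar>b\<bar>\<^sup>2\<close> by the parallelogram law, because
  \<open>\<bar>a\<^sup>2 - b\<^sup>2\<bar> + \<bar>a\<^sup>2 + b\<^sup>2\<bar> \<ge> 2 \<bar>a\<bar>\<^sup>2\<close>, while \<open>s, t \<ge> 2 \<bar>a\<bar>\<close>.
\<close>

lemma complex_rotation_gain:
  fixes a b :: complex
  shows "4 * sqrt ((cmod a)\<^sup>2 + (cmod b)\<^sup>2 / 4) \<le>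
    (cmod (a + b) + cmod (a - b)) + (cmod (a + \<i> * b) + cmod (a - \<i> * b))"
proof -
  have pair: "(cmod (a + d) + cmod (a - d))\<^sup>2 = 2 * (cmod a)\<^sup>2 + 2 * (cmod d)\<^sup>2 + 2 * cmod (a\<^sup>2 - d\<^sup>2)"
    for d
  proof -
    have "cmod (a + d) * cmod (a - d) = cmod (a\<^sup>2 - d\<^sup>2)"
      by (simp add: norm_mult[symmetric] algebra_simps power2_eq_square)
    moreover have "(cmod (a + d))\<^sup>2 + (cmod (a - d))\<^sup>2 = 2 * (cmod a)\<^sup>2 + 2 * (cmod d)\<^sup>2"
      unfolding cmod_power2 by (simp add: power2_eq_square algebra_simps)
    ultimately show ?thesis by (simp add: power2_sum)
  qed
  define s t where "s = cmod (a + b) + cmod (a - b)" and "t = cmod (a + \<i> * b) + cmod (a - \<i> * b)"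
  have "2 * cmod a = cmod ((a + d) + (a - d))" for d by (simp add: norm_mult mult_2[symmetric])
  then have ge: "2 * cmod a \<le> cmod (a + d) + cmod (a - d)" for d
    using norm_triangle_ineq[of "a + d" "a - d"] by simp
  have "2 * cmod a * (2 * cmod a) \<le> s * t"
    unfolding s_def t_def by (intro mult_mono ge) auto
  moreover have "2 * (cmod a)\<^sup>2 \<le> cmod (a\<^sup>2 - b\<^sup>2) + cmod (a\<^sup>2 - (\<i> * b)\<^sup>2)"
    using norm_triangle_ineq[of "a\<^sup>2 - b\<^sup>2" "a\<^sup>2 - (\<i> * b)\<^sup>2"]
    by (simp add: power_mult_distrib mult_2[symmetric] norm_mult norm_power)
  ultimately have "16 * ((cmod a)\<^sup>2 + (cmod b)\<^sup>2 / 4) \<le> (s + t)\<^sup>2"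
    using pair[of b, folded s_def] pair[of "\<i> * b", folded t_def]
    by (simp add: power2_sum norm_mult power2_eq_square algebra_simps)
  then have "sqrt (4\<^sup>2 * ((cmod a)\<^sup>2 + (cmod b)\<^sup>2 / 4)) \<le> s + t"
    by (intro real_le_lsqrt) (auto simp: s_def t_def)
  then show ?thesis unfolding s_def t_def real_sqrt_mult real_sqrt_abs by simp
qed

text \<open>
  Pointwise, the mean of \<open>\<bar>f + c g\<bar>\<close> over the four rotations is at least \<open>sqrt (\<bar>f\<bar>\<^sup>2 + \<bar>g\<bar>\<^sup>2 / 4)\<close>.
  With the norms \<open>U\<close> of \<open>f\<close> and \<open>V\<close> of \<open>g\<close> and \<open>R = sqrt (U\<^sup>2 + V\<^sup>2 / 4) > 0\<close> this dominates, by the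
  Cauchy-Schwarz inequality, the linear expression \<open>(U \<bar>f\<bar> + V \<bar>g\<bar> / 4) / R\<close>, whose integral is \<open>R\<close>. So the mean of the four norms is at least \<open>R\<close>, hence one of them is.
\<close>

lemma L1_rotation_gain:
  fixes f g :: "'a \<Rightarrow> complex"
  assumes f: "integrable M f" and g: "integrable M g"
  shows "\<exists>c. cmod c = 1 \<and> (LINT x|M. cmod (f x))\<^sup>2 + (LINT x|M. cmod (g x))\<^sup>2 / 4 \<le>
    (LINT x|M. cmod (f x + c * g x))\<^sup>2"
proof -
  define U V where "U = (LINT x|M. cmod (f x))" and "V = (LINT x|M. cmod (g x))"
  define R where "R = sqrt (U\<^sup>2 + V\<^sup>2 / 4)"
  have R0: "R \<ge> 0" and R2: "R\<^sup>2 = U\<^sup>2 + V\<^sup>2 / 4" by (auto simp: R_def)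
  define I where "I = (\<lambda>c. LINT x|M. cmod (f x + c * g x))"
  have I0: "I c \<ge> 0" for c by (simp add: I_def)
  define h where "h = (\<lambda>x. (cmod (f x + 1 * g x) + cmod (f x + (-1) * g x)) +
      (cmod (f x + \<i> * g x) + cmod (f x + (-\<i>) * g x)))"
  have int: "integrable M (\<lambda>x. cmod (f x + c * g x))" for c using f g by simp
  have inth: "integrable M h" unfolding h_def by (intro Bochner_Integration.integrable_add int)
  have point: "4 * (U * cmod (f x) + V / 4 * cmod (g x)) \<le> R * h x" for x
  proof -
    define u v where "u = cmod (f x)" and "v = cmod (g x)"
    have "(U * u + V / 4 * v)\<^sup>2 \<le> (U\<^sup>2 + V\<^sup>2 / 4) * (u\<^sup>2 + v\<^sup>2 / 4)"
    proof -
      have "(U\<^sup>2 + V\<^sup>2 / 4) * (u\<^sup>2 + v\<^sup>2 / 4) - (U * u + V / 4 * v)\<^sup>2 = (U * v - V * u)\<^sup>2 / 4"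
        by (simp add: power2_eq_square algebra_simps)
      moreover have "(U * v - V * u)\<^sup>2 / 4 \<ge> 0" by simp
      ultimately show ?thesis by linarith
    qed
    then have "U * u + V / 4 * v \<le> R * sqrt (u\<^sup>2 + v\<^sup>2 / 4)"
      unfolding R_def real_sqrt_mult[symmetric] by (rule real_le_rsqrt)
    then have "4 * (U * u + V / 4 * v) \<le> R * (4 * sqrt (u\<^sup>2 + v\<^sup>2 / 4))" by simp
    also have "\<dots> \<le> R * h x"
      using complex_rotation_gain[of "f x" "g x"]
      by (intro mult_left_mono R0) (simp add: u_def v_def h_def)
    finally show ?thesis unfolding u_def v_def .
  qed
  have "4 * (U * U + V / 4 * V) = (LINT x|M. 4 * (U * cmod (f x) + V / 4 * cmod (g x)))"
    using f g by (simp add: U_def[symmetric] V_def[symmetric])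
  also have "\<dots> \<le> (LINT x|M. R * h x)"
    using f g inth by (intro integral_mono point) auto
  also have "(LINT x|M. R * h x) = R * ((I 1 + I (-1)) + (I \<i> + I (- \<i>)))"
    unfolding h_def I_def by (simp only: integral_mult_right_zero Bochner_Integration.integral_add
        Bochner_Integration.integrable_add int)
  finally have sum: "4 * R\<^sup>2 \<le> R * ((I 1 + I (-1)) + (I \<i> + I (- \<i>)))"
    unfolding R2 by (simp add: power2_eq_square)
  have "\<exists>c. cmod c = 1 \<and> R \<le> I c"
  proof (rule ccontr)
    assume "\<not> ?thesis"
    then have lt: "I c < R" if "cmod c = 1" for c using that by force
    have "0 < R" using lt[of 1] I0[of 1] by simp
    then have "4 * R \<le> (I 1 + I (-1)) + (I \<i> + I (- \<i>))"
      using sum by (simp add: power2_eq_square mult.left_commute)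
    then show False using lt[of 1] lt[of "-1"] lt[of \<i>] lt[of "-\<i>"] by simp
  qed
  then obtain c where c: "cmod c = 1" "R \<le> I c" by blast
  have "R\<^sup>2 \<le> (I c)\<^sup>2" using c R0 by (intro power_mono)
  with c show ?thesis unfolding R2 I_def U_def V_def by blast
qed

section \<open>Gliding hump\<close>

lemma closed_C0: "closed (C0 :: ((real ^ 'n::finite) \<Rightarrow>\<^sub>C complex) set)"
proof (rule closed_sequential_limits[THEN iffD2], intro allI impI, elim conjE)
  fix F :: "nat \<Rightarrow> (real ^ 'n) \<Rightarrow>\<^sub>C complex" and G
  assume F: "\<forall>n. F n \<in> C0" and lim: "F \<longlonglongrightarrow> G"
  have "(apply_bcontfun G \<longlongrightarrow> 0) at_infinity"
  proof (rule swap_uniform_limit')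
    show "\<forall>\<^sub>F n in sequentially. (apply_bcontfun (F n) \<longlongrightarrow> 0) at_infinity"
      using F by (simp add: C0_def)
    show "uniform_limit UNIV (\<lambda>n. apply_bcontfun (F n)) (apply_bcontfun G) sequentially"
      using lim by (rule tendsto_bcontfun_uniform_limit)
  qed auto
  then show "G \<in> C0" by (simp add: C0_def)
qed

text \<open>
  In the step, \<open>G\<close> is at most \<open>\<delta>\<close> outside a ball. Adding a function that has norm \<open>1\<close> and is at most \<open>\<delta>\<close>
  on this ball gives the bound \<open>norm G + \<delta>\<close> inside and \<open>1 + \<delta>\<close> outside. The choice
  \<open>\<delta> = (1/2) ^ Suc N\<close> keeps both bounded by \<open>2\<close> through all steps. None of this depends on a rotation of the added
  function, which is therefore free to increase the squared \<open>L\<^sup>1\<close> norm by \<open>1/4\<close>.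
\<close>

lemma gliding_hump:
  fixes Y :: "((real ^ 'n::finite) \<Rightarrow>\<^sub>C complex) set"
  assumes sub: "bcontfunC.subspace Y" and C0: "Y \<subseteq> C0" and FL: "apply_bcontfun ` Y \<subseteq> FL1"
    and flat: "\<And>\<alpha> \<delta>. \<alpha> > 0 \<Longrightarrow> \<delta> > 0 \<Longrightarrow>
      \<exists>F\<in>Y. norm F = 1 \<and> (\<forall>\<xi>. norm \<xi> \<le> \<alpha> \<longrightarrow> cmod (apply_bcontfun F \<xi>) \<le> \<delta>)"
  shows "\<exists>G\<in>Y. \<exists>g. integrable lebesgue g \<and> apply_bcontfun G = fourier g \<and>
    norm G \<le> 2 - (1/2) ^ N \<and> real N / 4 \<le> (LINT x|lebesgue. cmod (g x))\<^sup>2"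
proof (induction N)
  case 0
  show ?case
    using bcontfunC.subspace_0[OF sub]
    by (intro bexI[of _ 0] exI[of _ "\<lambda>x. 0"]) (auto simp: fourier_zero)
next
  case (Suc N)
  then obtain G g where G: "G \<in> Y" and g: "integrable lebesgue g" "apply_bcontfun G = fourier g"
    and Gn: "norm G \<le> 2 - (1/2) ^ N" and gN: "real N / 4 \<le> (LINT x|lebesgue. cmod (g x))\<^sup>2"
    by blast
  define \<delta> :: real where "\<delta> = (1/2) ^ Suc N"
  have \<delta>: "\<delta> > 0" "\<delta> \<le> 1/2" "(1/2) ^ N = 2 * \<delta>"
    by (simp_all add: \<delta>_def power_le_one)
  have "(apply_bcontfun G \<longlongrightarrow> 0) at_infinity" using G C0 by (auto simp: C0_def)
  then have "\<forall>\<^sub>F \<xi> in at_infinity. cmod (G \<xi>) < \<delta>"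
    using \<delta>(1) by (auto dest: tendstoD)
  then obtain \<beta> where \<beta>: "\<And>\<xi>. \<beta> \<le> norm \<xi> \<Longrightarrow> cmod (G \<xi>) < \<delta>"
    unfolding eventually_at_infinity by blast
  obtain F where F: "F \<in> Y" "norm F = 1" and small: "\<And>\<xi>. norm \<xi> \<le> max 1 \<beta> \<Longrightarrow> cmod (apply_bcontfun F \<xi>) \<le> \<delta>"
    using flat[of "max 1 \<beta>" \<delta>] \<delta> by (auto simp: less_max_iff_disj)
  obtain f where f: "integrable lebesgue f" "apply_bcontfun F = fourier f"
    using F FL unfolding FL1_def by blast
  have "norm F \<le> (LINT x|lebesgue. cmod (f x))"
    by (rule norm_bound) (simp add: f(2) norm_fourier_le)
  then have "1 \<le> (LINT x|lebesgue. cmod (f x))\<^sup>2" using F(2) by simp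
  moreover obtain c where c: "cmod c = 1" and
    "(LINT x|lebesgue. cmod (g x))\<^sup>2 + (LINT x|lebesgue. cmod (f x))\<^sup>2 / 4 \<le>
      (LINT x|lebesgue. cmod (g x + c * f x))\<^sup>2"
    using L1_rotation_gain[OF g(1) f(1)] by blast
  ultimately have "real (Suc N) / 4 \<le> (LINT x|lebesgue. cmod (g x + c * f x))\<^sup>2"
    using gN by simp
  moreover have "G + scaleC_bcontfun c F \<in> Y"
    using sub G F by (intro bcontfunC.subspace_add bcontfunC.subspace_scale)
  moreover have "integrable lebesgue (\<lambda>x. g x + c * f x)" using f g by simp
  moreover have "apply_bcontfun (G + scaleC_bcontfun c F) = fourier (\<lambda>x. g x + c * f x)"
    using f g by (simp add: fun_eq_iff fourier_add fourier_cmult)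
  moreover have "norm (G + scaleC_bcontfun c F) \<le> 2 - (1/2) ^ Suc N"
  proof (rule norm_bound)
    fix \<xi>
    have tri: "cmod ((G + scaleC_bcontfun c F) \<xi>) \<le> cmod (G \<xi>) + cmod (apply_bcontfun F \<xi>)"
      using norm_triangle_ineq[of "G \<xi>" "c * F \<xi>"] c by (simp add: norm_mult)
    show "cmod ((G + scaleC_bcontfun c F) \<xi>) \<le> 2 - (1/2) ^ Suc N"
    proof (cases "norm \<xi> \<le> max 1 \<beta>")
      case True
      then show ?thesis
        using tri small[OF True] norm_bounded[of G \<xi>] Gn \<delta>(3) unfolding \<delta>_def[symmetric] by linarith
    next
      case False
      then have "cmod (G \<xi>) < \<delta>" by (intro \<beta>) simp
      then show ?thesis
        using tri norm_bounded[of F \<xi>] F(2) \<delta>(2) unfolding \<delta>_def[symmetric] by linarith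
    qed
  qed
  ultimately show ?case by blast
qed

theorem lemma6p1:
  fixes Y :: "((real ^ 'n::finite) \<Rightarrow>\<^sub>C complex) set"
  assumes "bcontfunC.subspace Y"
    and "closedin (top_of_set C0) Y"
    and "apply_bcontfun ` Y \<subseteq> FL1"
  shows "\<exists>\<alpha>>0. \<exists>C>0. \<forall>f. integrable lebesgue f \<and> fourier f \<in> apply_bcontfun ` Y \<longrightarrow>
    (SUP \<xi>. cmod (fourier f \<xi>)) \<le> C * (SUP \<xi>\<in>{\<xi>. norm \<xi> \<le> \<alpha>}. cmod (fourier f \<xi>))"
proof (rule ccontr)
  assume neg: "\<not> ?thesis"
  have C0: "Y \<subseteq> C0" using closedin_subset[OF assms(2)] by simp
  have cl: "closed Y" using closedin_closed_trans[OF assms(2) closed_C0] .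
  have scale: "r *\<^sub>R F \<in> Y" if "F \<in> Y" for r F
  proof -
    have "r *\<^sub>R F = scaleC_bcontfun (complex_of_real r) F"
      by (rule bcontfun_eqI) (simp add: scaleR_conv_of_real)
    then show ?thesis using bcontfunC.subspace_scale[OF assms(1) that] by simp
  qed
  have sub: "subspace Y"
    using bcontfunC.subspace_0[OF assms(1)] bcontfunC.subspace_add[OF assms(1)] scale
    by (auto simp: subspace_def)
  have flat: "\<exists>F\<in>Y. norm F = 1 \<and> (\<forall>\<xi>. norm \<xi> \<le> \<alpha> \<longrightarrow> cmod (apply_bcontfun F \<xi>) \<le> \<delta>)"
    if "\<alpha> > 0" "\<delta> > 0" for \<alpha> \<delta> :: real
  proof -
    define m where "m = (\<lambda>F :: (real ^ 'n) \<Rightarrow>\<^sub>C complex. SUP \<xi>\<in>{\<xi>. norm \<xi> \<le> \<alpha>}. cmod (apply_bcontfun F \<xi>))"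
    have "\<not> (\<forall>f. integrable lebesgue f \<and> fourier f \<in> apply_bcontfun ` Y \<longrightarrow>
        (SUP \<xi>. cmod (fourier f \<xi>)) \<le>
        inverse \<delta> * (SUP \<xi>\<in>{\<xi>. norm \<xi> \<le> \<alpha>}. cmod (fourier f \<xi>)))"
      using neg that positive_imp_inverse_positive by blast
    then obtain F where F: "F \<in> Y" and lt: "inverse \<delta> * m F < (SUP \<xi>. cmod (apply_bcontfun F \<xi>))"
      unfolding m_def by (auto simp: not_le)
    have le: "cmod (apply_bcontfun F \<xi>) \<le> m F" if "norm \<xi> \<le> \<alpha>" for \<xi>
      unfolding m_def
      by (rule cSUP_upper) (use that in \<open>auto intro!: bdd_aboveI2[where M="norm F"] norm_bounded\<close>)
    have "(SUP \<xi>. cmod (apply_bcontfun F \<xi>)) \<le> norm F" by (intro cSUP_least norm_bounded) simp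
    with lt have "inverse \<delta> * m F < norm F" by linarith
    then have lt': "m F < \<delta> * norm F"
      using \<open>\<delta> > 0\<close> by (simp add: field_simps)
    have "0 \<le> m F" using order.trans[OF norm_ge_zero le[of 0]] \<open>\<alpha> > 0\<close> by simp
    with lt' have pos: "norm F > 0" using \<open>\<delta> > 0\<close> by (cases "F = 0") auto
    show ?thesis
    proof (intro bexI[of _ "F /\<^sub>R norm F"] conjI allI impI)
      show "F /\<^sub>R norm F \<in> Y" by (rule scale[OF F])
      show "norm (F /\<^sub>R norm F) = 1" using pos by simp
      fix \<xi> :: "real ^ 'n" assume "norm \<xi> \<le> \<alpha>"
      then have "cmod (apply_bcontfun F \<xi>) \<le> \<delta> * norm F" using le lt' by fastforce
      then show "cmod ((F /\<^sub>R norm F) \<xi>) \<le> \<delta>" using pos by (simp add: field_simps)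
    qed
  qed
  obtain K where K: "K \<ge> 0" and inv: "\<And>F. F \<in> Y \<Longrightarrow> \<exists>f. integrable lebesgue f \<and>
      apply_bcontfun F = fourier f \<and> (LINT x|lebesgue. cmod (f x)) \<le> K * norm F"
    using bounded_fourier_inverse[OF sub cl assms(3)] by blast
  obtain N :: nat where N: "4 * (2 * K)\<^sup>2 < real N" using reals_Archimedean2 by blast
  obtain G g where G: "G \<in> Y" "norm G \<le> 2 - (1/2) ^ N"
    and g: "integrable lebesgue g" "apply_bcontfun G = fourier g"
    and gN: "real N / 4 \<le> (LINT x|lebesgue. cmod (g x))\<^sup>2"
    using gliding_hump[OF assms(1) C0 assms(3) flat, of N] by blast
  obtain f where f: "integrable lebesgue f" "apply_bcontfun G = fourier f"
    and fK: "(LINT x|lebesgue. cmod (f x)) \<le> K * norm G"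
    using inv[OF G(1)] by blast
  have "(LINT x|lebesgue. cmod (g x)) = (LINT x|lebesgue. cmod (f x))"
    using f g by (intro L1_norm_eq_if_fourier_eq) auto
  also have "\<dots> \<le> K * norm G" by (rule fK)
  also have "\<dots> \<le> K * 2"
    using G(2) zero_le_power[of "1/2::real" N] by (intro mult_left_mono K) linarith
  finally have "(LINT x|lebesgue. cmod (g x))\<^sup>2 \<le> (K * 2)\<^sup>2"
    by (intro power_mono) simp_all
  with gN N show False by (simp add: mult.commute)
qed

end
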